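(* For any proper metric monoids $(G_1,\delta_1)$, $(G_2,\delta_2)$ and $(G_3,\delta_3)$: 1. $\Upsilon((G_1,\delta_1),(G_2,\delta_2))\le\frac{\sqrt2}{2}$; 2. $\Upsilon((G_1,\delta_1),(G_2,\delta_2))=\Upsilon((G_2,\delta_2),(G_1,\delta_1))$; 3. $\Upsilon((G_1,\delta_1),(G_3,\delta_3))\le\Upsilon((G_1,\delta_1),(G_2,\delta_2))+\Upsilon((G_2,\delta_2),(G_3,\delta_3))$; 4. $\Upsilon((G_1,\delta_1),(G_2,\delta_2))=0$ if and only if there exists a monoid isometric isomorphism from $(G_1,\delta_1)$ to $(G_2,\delta_2)$. In particular, $\Upsilon$ is a metric up to metric group isometric isomorphism on the class of proper metric groups.
   Context: A *metric monoid* $(G,\delta)$ is a monoid $G$ with a left-invariant metric $\delta$ (i.e. $\delta(gh,gh')=\delta(h,h')$) for which multiplication is continuous; a *metric group* is a group with a left-invariant metric for which multiplication and inversion are continuous. It is *proper* when all its closed balls are compact. $G[r]$ denotes the closed ball of radius $r$ centered at the identity. A monoid isometric isomorphism is a bijective isometry which is a monoid morphism (multiplicative and mapping identity to identity); similarly for groups. For metric monoids $(G_1,\delta_1),(G_2,\delta_2)$ with identities $e_1,e_2$, and $\varepsilon,r\ge0$, let $\mathsf{UIso}_\varepsilon((G_1,\delta_1)\to(G_2,\delta_2)|r)$ be the set of ordered pairs of maps $\varsigma_1:G_1[r]\to G_2$, $\varsigma_2:G_2[r]\to G_1$ such that for all $\{j,k\}=\{1,2\}$: $\varsigma_j(e_j)=e_k$,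 and for all $g,g'\in G_j[r]$, $h\in G_k[r]$, $|\delta_k(\varsigma_j(g)\varsigma_j(g'),h)-\delta_j(gg',\varsigma_k(h))|\le\varepsilon$. For proper metric monoids, $$\Upsilon((G_1,\delta_1),(G_2,\delta_2))=\min\Big\{\tfrac{\sqrt2}{2},\inf\{\varepsilon>0:\mathsf{UIso}_\varepsilon((G_1,\delta_1)\to(G_2,\delta_2)|\tfrac1\varepsilon)\ne\emptyset\}\Big\}.$$ *)

theory Defs
  imports "HOL-Analysis.Abstract_Metric_Spaces" "HOL-Algebra.Group"
begin

text \<open>The locale \<open>Metric_space\<close> asks nonnegativity and symmetry of \<open>d\<close> on the whole type; off the
  carrier this is only a convention on junk values, which play no role below.\<close>

locale metric_monoid = monoid G + Metric_space "carrier G" d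
  for G :: "('a, 'm) monoid_scheme" (structure) and d :: "'a \<Rightarrow> 'a \<Rightarrow> real" +
  assumes left_invariant:
      "\<lbrakk>g \<in> carrier G; h \<in> carrier G; h' \<in> carrier G\<rbrakk> \<Longrightarrow> d (g \<otimes> h) (g \<otimes> h') = d h h'"
    and continuous_mult:
      "continuous_map (prod_topology mtopology mtopology) mtopology (\<lambda>(g, h). g \<otimes> h)"

locale metric_group = metric_monoid G d + group G
  for G :: "('a, 'm) monoid_scheme" (structure) and d :: "'a \<Rightarrow> 'a \<Rightarrow> real" +
  assumes continuous_inv: "continuous_map mtopology mtopology (\<lambda>g. inv g)"

locale proper_metric_monoid = metric_monoid +
  assumes proper: "x \<in> carrier G \<Longrightarrow> compactin mtopology (mcball x r)"

locale proper_metric_group = metric_group +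
  assumes proper: "x \<in> carrier G \<Longrightarrow> compactin mtopology (mcball x r)"

definition idball :: "('a, 'm) monoid_scheme \<Rightarrow> ('a \<Rightarrow> 'a \<Rightarrow> real) \<Rightarrow> real \<Rightarrow> 'a set" where
  "idball G d r = Metric_space.mcball (carrier G) d \<one>\<^bsub>G\<^esub> r"

text \<open>Maps with domain \<open>G[r]\<close> are represented as extensional functions (\<open>\<rightarrow>\<^sub>E\<close>).\<close>

definition UIso ::
  "real \<Rightarrow> ('a, 'm) monoid_scheme \<Rightarrow> ('a \<Rightarrow> 'a \<Rightarrow> real) \<Rightarrow>
   ('b, 'n) monoid_scheme \<Rightarrow> ('b \<Rightarrow> 'b \<Rightarrow> real) \<Rightarrow> real \<Rightarrow> (('a \<Rightarrow> 'b) \<times> ('b \<Rightarrow> 'a)) set" where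
  "UIso \<epsilon> G1 d1 G2 d2 r =
    {(s1, s2).
       s1 \<in> idball G1 d1 r \<rightarrow>\<^sub>E carrier G2 \<and>
       s2 \<in> idball G2 d2 r \<rightarrow>\<^sub>E carrier G1 \<and>
       s1 \<one>\<^bsub>G1\<^esub> = \<one>\<^bsub>G2\<^esub> \<and>
       s2 \<one>\<^bsub>G2\<^esub> = \<one>\<^bsub>G1\<^esub> \<and>
       (\<forall>g\<in>idball G1 d1 r. \<forall>g'\<in>idball G1 d1 r. \<forall>h\<in>idball G2 d2 r.
          \<bar>d2 (s1 g \<otimes>\<^bsub>G2\<^esub> s1 g') h - d1 (g \<otimes>\<^bsub>G1\<^esub> g') (s2 h)\<bar> \<le> \<epsilon>) \<and>
       (\<forall>g\<in>idball G2 d2 r. \<forall>g'\<in>idball G2 d2 r. \<forall>h\<in>idball G1 d1 r.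
          \<bar>d1 (s2 g \<otimes>\<^bsub>G1\<^esub> s2 g') h - d2 (g \<otimes>\<^bsub>G2\<^esub> g') (s1 h)\<bar> \<le> \<epsilon>)}"

text \<open>The infimum is a real one; its set is bounded below by \<open>0\<close> and, for metric monoids,
  nonempty (lemma \<open>UIso_sqrt2\<close> below), so the arbitrary value \<open>Inf {}\<close> never enters.\<close>

definition Upsilon ::
  "('a, 'm) monoid_scheme \<Rightarrow> ('a \<Rightarrow> 'a \<Rightarrow> real) \<Rightarrow>
   ('b, 'n) monoid_scheme \<Rightarrow> ('b \<Rightarrow> 'b \<Rightarrow> real) \<Rightarrow> real" where
  "Upsilon G1 d1 G2 d2 =
    min (sqrt 2 / 2) (Inf {\<epsilon>. \<epsilon> > 0 \<and> UIso \<epsilon> G1 d1 G2 d2 (1 / \<epsilon>) \<noteq> {}})"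

definition monoid_isometric_isomorphisms ::
  "('a, 'm) monoid_scheme \<Rightarrow> ('a \<Rightarrow> 'a \<Rightarrow> real) \<Rightarrow>
   ('b, 'n) monoid_scheme \<Rightarrow> ('b \<Rightarrow> 'b \<Rightarrow> real) \<Rightarrow> ('a \<Rightarrow> 'b) set" where
  "monoid_isometric_isomorphisms G1 d1 G2 d2 =
    {f \<in> iso G1 G2. f \<one>\<^bsub>G1\<^esub> = \<one>\<^bsub>G2\<^esub> \<and>
       (\<forall>x\<in>carrier G1. \<forall>y\<in>carrier G1. d2 (f x) (f y) = d1 x y)}"

definition group_isometric_isomorphisms ::
  "('a, 'm) monoid_scheme \<Rightarrow> ('a \<Rightarrow> 'a \<Rightarrow> real) \<Rightarrow>
   ('b, 'n) monoid_scheme \<Rightarrow> ('b \<Rightarrow> 'b \<Rightarrow> real) \<Rightarrow> ('a \<Rightarrow> 'b) set" where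
  "group_isometric_isomorphisms G1 d1 G2 d2 =
    {f \<in> iso G1 G2. \<forall>x\<in>carrier G1. \<forall>y\<in>carrier G1. d2 (f x) (f y) = d1 x y}"

lemma (in metric_monoid) dist_one_mult_le:
  assumes "g \<in> idball G d r" "g' \<in> idball G d r"
  shows "d (g \<otimes> g') \<one> \<le> 2 * r"
proof -
  have gg: "g \<in> carrier G" "d \<one> g \<le> r" "g' \<in> carrier G" "d \<one> g' \<le> r"
    using assms by (auto simp: idball_def)
  have "d \<one> (g \<otimes> g') \<le> d \<one> g + d g (g \<otimes> g')"
    using gg by (intro triangle) auto
  also have "d g (g \<otimes> g') = d \<one> g'"
    using left_invariant[of g \<one> g'] gg by simp
  finally show ?thesis using gg by (simp add: commute)
qed

lemma UIso_sqrt2: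
  assumes "metric_monoid G1 d1" "metric_monoid G2 d2"
  shows "UIso (sqrt 2) G1 d1 G2 d2 (1 / sqrt 2) \<noteq> {}"
proof -
  interpret A: metric_monoid G1 d1 by fact
  interpret B: metric_monoid G2 d2 by fact
  let ?r = "1 / sqrt 2 :: real"
  define s1 where "s1 = restrict (\<lambda>_. \<one>\<^bsub>G2\<^esub>) (idball G1 d1 ?r)"
  define s2 where "s2 = restrict (\<lambda>_. \<one>\<^bsub>G1\<^esub>) (idball G2 d2 ?r)"
  have r: "2 * ?r = sqrt 2" "?r \<ge> 0" "?r \<le> sqrt 2"
    by (simp_all add: field_simps)
  have bound: "\<bar>a - b\<bar> \<le> sqrt 2" if "0 \<le> a" "a \<le> ?r" "0 \<le> b" "b \<le> 2 * ?r" for a b :: real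
    using that r by linarith
  have one: "\<one>\<^bsub>G1\<^esub> \<in> idball G1 d1 ?r" "\<one>\<^bsub>G2\<^esub> \<in> idball G2 d2 ?r"
    using r by (auto simp: idball_def)
  have ball1: "d1 \<one>\<^bsub>G1\<^esub> h \<le> ?r" if "h \<in> idball G1 d1 ?r" for h
    using that by (auto simp: idball_def)
  have ball2: "d2 \<one>\<^bsub>G2\<^esub> h \<le> ?r" if "h \<in> idball G2 d2 ?r" for h
    using that by (auto simp: idball_def)
  have "(s1, s2) \<in> UIso (sqrt 2) G1 d1 G2 d2 ?r"
    unfolding UIso_def
    using one A.dist_one_mult_le[of _ ?r] B.dist_one_mult_le[of _ ?r] ball1 ball2
    by (auto simp: s1_def s2_def simp del: times_divide_eq_right intro!: bound)
  then show ?thesis by blast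
qed

end

theory Submission
  imports Defs "HOL-Real_Asymp.Real_Asymp"
begin

text \<open>
  Everything rests on one quantity, the defect of a pair \<open>(s, t)\<close>: the amount by which
  \<open>d2 (s g \<otimes> s g') h\<close> can differ from \<open>d1 (g \<otimes> g') (t h)\<close>. Elements of \<open>UIso \<epsilon>\<close> are the
  unit-preserving pairs for which the defects of \<open>(s, t)\<close> and of \<open>(t, s)\<close> are at most \<open>\<epsilon>\<close>, so
  symmetry is built in.

  Triangle inequality. Defects add under composition (\<open>defect_le_comp\<close>), provided the
  intermediate points stay in the balls where the outer maps are controlled. A map of defect
  \<open>\<epsilon>\<close> enlarges the distance to the unit by at most \<open>\<epsilon>\<close>, and
  \<open>1 / (\<epsilon> + \<epsilon>') + \<epsilon> \<le> 1 / \<epsilon>'\<close> as long as \<open>\<epsilon> + \<epsilon>' \<le> 1\<close> (\<open>radius_margin\<close>): the shorter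
  radius demanded of the composite leaves exactly this room. The cap \<open>sqrt 2 / 2\<close> in \<open>Upsilon\<close>
  makes every sum above \<open>1\<close> harmless.

  Vanishing. A unit-preserving pair of defect zero on the whole carriers consists of mutually inverse isometric morphisms
  (\<open>zero_defect_isometric_isomorphism\<close>): putting \<open>h = s g\<close> in \<open>d2 (s g) h = d1 g (t h)\<close> gives
  \<open>t (s g) = g\<close>, and putting \<open>h = s (g \<otimes> g')\<close> in the full identity gives multiplicativity. To
  produce such a pair from \<open>Upsilon = 0\<close>, note that unit-preserving pairs of defect at most \<open>1\<close> send each \<open>g\<close>
  into the closed ball of radius \<open>d1 \<one> g + 1\<close>. These balls are compact by properness, so by
  Tychonoff all candidate pairs live in one compact product space. The pairs with defect at most
  \<open>1 / (n + 2)\<close> on the balls of radius \<open>n\<close> form a decreasing sequence of closed sets, nonempty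
  because \<open>Upsilon = 0\<close>; a point common to all of them has defect zero everywhere. Taking the
  limit of both maps at once is what makes the limit of the second the inverse of the first.
\<close>

section \<open>The multiplicative defect of a pair of maps\<close>

text \<open>
  This is one half of the condition defining \<open>UIso\<close>, with two independent domains so that it can
  also be applied to whole carriers and, in compositions, to balls of different radii.
\<close>

definition defect_le ::
  "real \<Rightarrow> ('a, 'm) monoid_scheme \<Rightarrow> ('a \<Rightarrow> 'a \<Rightarrow> real) \<Rightarrow>
   ('b, 'n) monoid_scheme \<Rightarrow> ('b \<Rightarrow> 'b \<Rightarrow> real) \<Rightarrow>
   'a set \<Rightarrow> 'b set \<Rightarrow> ('a \<Rightarrow> 'b) \<Rightarrow> ('b \<Rightarrow> 'a) \<Rightarrow> bool" where
  "defect_le \<epsilon> G1 d1 G2 d2 A B s t \<longleftrightarrow>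
    (\<forall>g\<in>A. \<forall>g'\<in>A. \<forall>h\<in>B. \<bar>d2 (s g \<otimes>\<^bsub>G2\<^esub> s g') h - d1 (g \<otimes>\<^bsub>G1\<^esub> g') (t h)\<bar> \<le> \<epsilon>)"

lemma defect_leD:
  assumes "defect_le \<epsilon> G1 d1 G2 d2 A B s t" "g \<in> A" "g' \<in> A" "h \<in> B"
  shows "\<bar>d2 (s g \<otimes>\<^bsub>G2\<^esub> s g') h - d1 (g \<otimes>\<^bsub>G1\<^esub> g') (t h)\<bar> \<le> \<epsilon>"
  using assms by (simp add: defect_le_def)

lemma defect_le_mono:
  assumes "defect_le \<epsilon> G1 d1 G2 d2 A B s t" "A' \<subseteq> A" "B' \<subseteq> B" "\<epsilon> \<le> \<epsilon>'"
  shows "defect_le \<epsilon>' G1 d1 G2 d2 A' B' s t"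
  unfolding defect_le_def
proof (intro ballI)
  fix g g' h assume "g \<in> A'" "g' \<in> A'" "h \<in> B'"
  then have "g \<in> A" "g' \<in> A" "h \<in> B" using assms by auto
  from defect_leD[OF assms(1) this] assms(4)
  show "\<bar>d2 (s g \<otimes>\<^bsub>G2\<^esub> s g') h - d1 (g \<otimes>\<^bsub>G1\<^esub> g') (t h)\<bar> \<le> \<epsilon>'" by linarith
qed

lemma defect_le_cong:
  assumes "\<And>g. g \<in> A \<Longrightarrow> s g = s' g" "\<And>h. h \<in> B \<Longrightarrow> t h = t' h"
  shows "defect_le \<epsilon> G1 d1 G2 d2 A B s t \<longleftrightarrow> defect_le \<epsilon> G1 d1 G2 d2 A B s' t'"
  using assms by (simp add: defect_le_def)

text \<open>
  The number \<open>d2 (s g \<otimes> s g') (t' h)\<close> is compared with both quantities in the defect of the composite: the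
  defect of the outer pair \<open>(t, t')\<close> controls its distance to the first one, that of the inner
  pair its distance to the second. This matching is the reason for measuring the failure of
  multiplicativity through a third point rather than comparing \<open>s (g \<otimes> g')\<close> with \<open>s g \<otimes> s g'\<close>.
\<close>

lemma defect_le_comp:
  assumes "defect_le \<epsilon> G1 d1 G2 d2 A B s s'" "defect_le \<epsilon>' G2 d2 G3 d3 B' C t t'"
    and "A' \<subseteq> A" "C' \<subseteq> C" "s ` A' \<subseteq> B'" "t' ` C' \<subseteq> B"
  shows "defect_le (\<epsilon> + \<epsilon>') G1 d1 G3 d3 A' C' (t \<circ> s) (s' \<circ> t')"
  unfolding defect_le_def
proof (intro ballI)
  fix g g' h assume *: "g \<in> A'" "g' \<in> A'" "h \<in> C'"
  have "\<bar>d3 (t (s g) \<otimes>\<^bsub>G3\<^esub> t (s g')) h - d2 (s g \<otimes>\<^bsub>G2\<^esub> s g') (t' h)\<bar> \<le> \<epsilon>'"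
    by (rule defect_leD[OF assms(2)]) (use * assms in auto)
  moreover have "\<bar>d2 (s g \<otimes>\<^bsub>G2\<^esub> s g') (t' h) - d1 (g \<otimes>\<^bsub>G1\<^esub> g') (s' (t' h))\<bar> \<le> \<epsilon>"
    by (rule defect_leD[OF assms(1)]) (use * assms in auto)
  ultimately show "\<bar>d3 ((t \<circ> s) g \<otimes>\<^bsub>G3\<^esub> (t \<circ> s) g') h - d1 (g \<otimes>\<^bsub>G1\<^esub> g') ((s' \<circ> t') h)\<bar> \<le> \<epsilon> + \<epsilon>'"
    by simp
qed

lemma UIso_iff:
  "(s, t) \<in> UIso \<epsilon> G1 d1 G2 d2 r \<longleftrightarrow>
     s \<in> idball G1 d1 r \<rightarrow>\<^sub>E carrier G2 \<and> t \<in> idball G2 d2 r \<rightarrow>\<^sub>E carrier G1 \<and>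
     s \<one>\<^bsub>G1\<^esub> = \<one>\<^bsub>G2\<^esub> \<and> t \<one>\<^bsub>G2\<^esub> = \<one>\<^bsub>G1\<^esub> \<and>
     defect_le \<epsilon> G1 d1 G2 d2 (idball G1 d1 r) (idball G2 d2 r) s t \<and>
     defect_le \<epsilon> G2 d2 G1 d1 (idball G2 d2 r) (idball G1 d1 r) t s"
  by (simp add: UIso_def defect_le_def)

lemma UIso_swap: "(s, t) \<in> UIso \<epsilon> G1 d1 G2 d2 r \<longleftrightarrow> (t, s) \<in> UIso \<epsilon> G2 d2 G1 d1 r"
  by (auto simp: UIso_iff)

text \<open>
  Maps defined beyond the ball become extensional by restriction; the units lie in the balls
  because \<open>r\<close> is nonnegative, so restricting does not disturb the values there.
\<close>

lemma UIso_restrictI: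
  assumes "0 \<le> r" "metric_monoid G1 d1" "metric_monoid G2 d2"
    and "s ` idball G1 d1 r \<subseteq> carrier G2" "t ` idball G2 d2 r \<subseteq> carrier G1"
    and "s \<one>\<^bsub>G1\<^esub> = \<one>\<^bsub>G2\<^esub>" "t \<one>\<^bsub>G2\<^esub> = \<one>\<^bsub>G1\<^esub>"
    and "defect_le \<epsilon> G1 d1 G2 d2 (idball G1 d1 r) (idball G2 d2 r) s t"
    and "defect_le \<epsilon> G2 d2 G1 d1 (idball G2 d2 r) (idball G1 d1 r) t s"
  shows "(restrict s (idball G1 d1 r), restrict t (idball G2 d2 r)) \<in> UIso \<epsilon> G1 d1 G2 d2 r"
proof -
  interpret A: metric_monoid G1 d1 by fact
  interpret B: metric_monoid G2 d2 by fact
  have "\<one>\<^bsub>G1\<^esub> \<in> idball G1 d1 r" "\<one>\<^bsub>G2\<^esub> \<in> idball G2 d2 r"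
    using assms(1) by (auto simp: idball_def)
  then show ?thesis
    using assms by (auto simp: UIso_iff cong: defect_le_cong)
qed

lemma (in metric_monoid) idball_iff: "g \<in> idball G d r \<longleftrightarrow> g \<in> carrier G \<and> d \<one> g \<le> r"
  by (auto simp: idball_def)

lemma (in metric_monoid) idball_mono: "r \<le> r' \<Longrightarrow> idball G d r \<subseteq> idball G d r'"
  by (auto simp: idball_iff)

section \<open>Composition of approximate isomorphisms\<close>

text \<open>Taking \<open>g' = \<one>\<close> in the defect shows that the two maps are almost adjoint for the metrics.\<close>

lemma UIso_dist:
  assumes "metric_monoid G1 d1" "metric_monoid G2 d2" "(s, t) \<in> UIso \<epsilon> G1 d1 G2 d2 r" "0 \<le> r"
    and "g \<in> idball G1 d1 r" "h \<in> idball G2 d2 r"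
  shows "\<bar>d2 (s g) h - d1 g (t h)\<bar> \<le> \<epsilon>"
proof -
  interpret A: metric_monoid G1 d1 by fact
  interpret B: metric_monoid G2 d2 by fact
  have "\<one>\<^bsub>G1\<^esub> \<in> idball G1 d1 r" "g \<in> carrier G1" "s g \<in> carrier G2" "s \<one>\<^bsub>G1\<^esub> = \<one>\<^bsub>G2\<^esub>"
    using assms by (auto simp: A.idball_iff UIso_iff)
  then show ?thesis
    using assms defect_leD[of \<epsilon> G1 d1 G2 d2 "idball G1 d1 r" "idball G2 d2 r" s t g "\<one>\<^bsub>G1\<^esub>" h]
    by (auto simp: UIso_iff)
qed

text \<open>
  Taking \<open>h = \<one>\<close> in \<open>UIso_dist\<close>, the distance to the unit changes by at most \<open>\<epsilon>\<close>. This keeps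
  composites inside the right balls, and confines the values at each point to a compact ball.
\<close>

lemma UIso_idball_image:
  assumes "metric_monoid G1 d1" "metric_monoid G2 d2" "(s, t) \<in> UIso \<epsilon> G1 d1 G2 d2 r" "0 \<le> r"
    and "g \<in> idball G1 d1 r" "d1 \<one>\<^bsub>G1\<^esub> g + \<epsilon> \<le> R"
  shows "s g \<in> idball G2 d2 R"
proof -
  interpret A: metric_monoid G1 d1 by fact
  interpret B: metric_monoid G2 d2 by fact
  have "\<one>\<^bsub>G2\<^esub> \<in> idball G2 d2 r" "s g \<in> carrier G2" "t \<one>\<^bsub>G2\<^esub> = \<one>\<^bsub>G1\<^esub>"
    using assms by (auto simp: B.idball_iff UIso_iff)
  then show ?thesis
    using UIso_dist[OF assms(1-5), of "\<one>\<^bsub>G2\<^esub>"] assms(6)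
    by (simp add: B.idball_iff A.commute B.commute)
qed

lemma UIso_comp:
  assumes "metric_monoid G1 d1" "metric_monoid G2 d2" "metric_monoid G3 d3"
    and st: "(s, s') \<in> UIso \<epsilon> G1 d1 G2 d2 r1" and tt: "(t, t') \<in> UIso \<epsilon>' G2 d2 G3 d3 r2"
    and r: "0 \<le> r" "0 \<le> \<epsilon>" "0 \<le> \<epsilon>'" "r + \<epsilon> \<le> r2" "r + \<epsilon>' \<le> r1"
  shows "(restrict (t \<circ> s) (idball G1 d1 r), restrict (s' \<circ> t') (idball G3 d3 r))
           \<in> UIso (\<epsilon> + \<epsilon>') G1 d1 G3 d3 r"
proof -
  interpret A: metric_monoid G1 d1 by fact
  interpret B: metric_monoid G2 d2 by fact
  interpret C: metric_monoid G3 d3 by fact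
  have tt': "(t', t) \<in> UIso \<epsilon>' G3 d3 G2 d2 r2"
    using tt by (rule UIso_swap[THEN iffD1])
  have subA: "idball G1 d1 r \<subseteq> idball G1 d1 r1" and subC: "idball G3 d3 r \<subseteq> idball G3 d3 r2"
    using r by (auto intro!: A.idball_mono C.idball_mono)
  have s: "s g \<in> idball G2 d2 r2" if "g \<in> idball G1 d1 r" for g
    by (rule UIso_idball_image[OF assms(1,2) st]) (use that subA r in \<open>auto simp: A.idball_iff\<close>)
  have t': "t' g \<in> idball G2 d2 r1" if "g \<in> idball G3 d3 r" for g
    by (rule UIso_idball_image[OF assms(3,2) tt']) (use that subC r in \<open>auto simp: C.idball_iff\<close>)
  show ?thesis
  proof (rule UIso_restrictI)
    show "defect_le (\<epsilon> + \<epsilon>') G1 d1 G3 d3 (idball G1 d1 r) (idball G3 d3 r) (t \<circ> s) (s' \<circ> t')"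
      by (rule defect_le_comp[where A = "idball G1 d1 r1" and B = "idball G2 d2 r1"
            and B' = "idball G2 d2 r2" and C = "idball G3 d3 r2"])
        (use st tt subA subC s t' in \<open>auto simp: UIso_iff\<close>)
    have "defect_le (\<epsilon>' + \<epsilon>) G3 d3 G1 d1 (idball G3 d3 r) (idball G1 d1 r) (s' \<circ> t') (t \<circ> s)"
      by (rule defect_le_comp[where A = "idball G3 d3 r2" and B = "idball G2 d2 r2"
            and B' = "idball G2 d2 r1" and C = "idball G1 d1 r1"])
        (use st tt subA subC s t' in \<open>auto simp: UIso_iff\<close>)
    then show "defect_le (\<epsilon> + \<epsilon>') G3 d3 G1 d1 (idball G3 d3 r) (idball G1 d1 r) (s' \<circ> t') (t \<circ> s)"
      by (simp add: add.commute)
  qed (use assms s t' in \<open>auto simp: UIso_iff\<close>)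
qed

section \<open>Elementary properties of \<open>Upsilon\<close>\<close>

lemma UIso_scales_bdd_below: "bdd_below {\<epsilon>::real. \<epsilon> > 0 \<and> UIso \<epsilon> G1 d1 G2 d2 (1 / \<epsilon>) \<noteq> {}}"
  by (rule bdd_belowI[of _ 0]) auto

lemma UIso_scales_nonempty:
  assumes "metric_monoid G1 d1" "metric_monoid G2 d2"
  shows "{\<epsilon>::real. \<epsilon> > 0 \<and> UIso \<epsilon> G1 d1 G2 d2 (1 / \<epsilon>) \<noteq> {}} \<noteq> {}"
  using UIso_sqrt2[OF assms] by (auto intro!: exI[of _ "sqrt 2"])

lemma Upsilon_le:
  assumes "(s, t) \<in> UIso \<epsilon> G1 d1 G2 d2 (1 / \<epsilon>)" "\<epsilon> > 0"
  shows "Upsilon G1 d1 G2 d2 \<le> \<epsilon>"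
proof -
  have "Inf {\<epsilon>. \<epsilon> > 0 \<and> UIso \<epsilon> G1 d1 G2 d2 (1 / \<epsilon>) \<noteq> {}} \<le> \<epsilon>"
    by (rule cInf_lower[OF _ UIso_scales_bdd_below]) (use assms in auto)
  then show ?thesis by (simp add: Upsilon_def)
qed

lemma Upsilon_le_sqrt2: "Upsilon G1 d1 G2 d2 \<le> sqrt 2 / 2"
  by (simp add: Upsilon_def)

lemma Upsilon_nonneg:
  assumes "metric_monoid G1 d1" "metric_monoid G2 d2"
  shows "0 \<le> Upsilon G1 d1 G2 d2"
  using cInf_greatest[OF UIso_scales_nonempty[OF assms], of 0] by (auto simp: Upsilon_def)

lemma Upsilon_lessE:
  assumes "metric_monoid G1 d1" "metric_monoid G2 d2"
    and "Upsilon G1 d1 G2 d2 < x" "x \<le> sqrt 2 / 2"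
  obtains \<epsilon> s t where "0 < \<epsilon>" "\<epsilon> < x" "(s, t) \<in> UIso \<epsilon> G1 d1 G2 d2 (1 / \<epsilon>)"
proof -
  have "Inf {\<epsilon>. \<epsilon> > 0 \<and> UIso \<epsilon> G1 d1 G2 d2 (1 / \<epsilon>) \<noteq> {}} < x"
    using assms(3,4) by (auto simp: Upsilon_def)
  from cInf_lessD[OF UIso_scales_nonempty[OF assms(1,2)] this] show ?thesis
    using that by auto
qed

lemma Upsilon_commute: "Upsilon G1 d1 G2 d2 = Upsilon G2 d2 G1 d1"
proof -
  have "UIso \<epsilon> G1 d1 G2 d2 r \<noteq> {} \<longleftrightarrow> UIso \<epsilon> G2 d2 G1 d1 r \<noteq> {}" for \<epsilon> r
    using UIso_swap[of _ _ \<epsilon> G1 d1 G2 d2 r] by fast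
  then show ?thesis by (simp add: Upsilon_def)
qed

text \<open>
  After clearing denominators this is \<open>b * (a + b) \<le> 1\<close>. It is the comparison of radii that lets
  two approximate isomorphisms be composed on the ball of radius \<open>1 / (a + b)\<close>.
\<close>

lemma radius_margin:
  fixes a b :: real
  assumes "0 < a" "0 < b" "a + b \<le> 1"
  shows "1 / (a + b) + a \<le> 1 / b"
proof -
  have "b * (a + b) \<le> 1"
    using assms mult_mono[of b 1 "a + b" 1] by simp
  then have "a * (b * (a + b)) \<le> a"
    using assms mult_left_mono[of "b * (a + b)" 1 a] by simp
  then have "(1 + a * (a + b)) * b \<le> 1 * (a + b)"
    by (simp add: algebra_simps)
  then have "(1 + a * (a + b)) / (a + b) \<le> 1 / b"
    using assms by (simp add: frac_le_eq divide_le_eq field_simps)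
  then show ?thesis
    using assms by (simp add: add_divide_distrib)
qed

lemma Upsilon_triangle:
  assumes "metric_monoid G1 d1" "metric_monoid G2 d2" "metric_monoid G3 d3"
  shows "Upsilon G1 d1 G3 d3 \<le> Upsilon G1 d1 G2 d2 + Upsilon G2 d2 G3 d3"
proof (rule ccontr)
  assume less: "\<not> ?thesis"
  \<comment> \<open>Half of the assumed gap is given to each of the two approximating scales.\<close>
  define \<eta> where "\<eta> = (Upsilon G1 d1 G3 d3 - (Upsilon G1 d1 G2 d2 + Upsilon G2 d2 G3 d3)) / 2"
  have \<eta>: "0 < \<eta>"
    "Upsilon G1 d1 G2 d2 + \<eta> + (Upsilon G2 d2 G3 d3 + \<eta>) = Upsilon G1 d1 G3 d3"
    using less by (simp_all add: \<eta>_def field_simps)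
  note nonneg = Upsilon_nonneg[OF assms(1,2)] Upsilon_nonneg[OF assms(2,3)]
  note bound = Upsilon_le_sqrt2[of G1 d1 G3 d3]
  obtain \<epsilon> s s' where 1: "0 < \<epsilon>" "\<epsilon> < Upsilon G1 d1 G2 d2 + \<eta>"
      "(s, s') \<in> UIso \<epsilon> G1 d1 G2 d2 (1 / \<epsilon>)"
    by (rule Upsilon_lessE[OF assms(1,2), of "Upsilon G1 d1 G2 d2 + \<eta>"]) (use \<eta> nonneg bound in auto)
  obtain \<epsilon>' t t' where 2: "0 < \<epsilon>'" "\<epsilon>' < Upsilon G2 d2 G3 d3 + \<eta>"
      "(t, t') \<in> UIso \<epsilon>' G2 d2 G3 d3 (1 / \<epsilon>')"
    by (rule Upsilon_lessE[OF assms(2,3), of "Upsilon G2 d2 G3 d3 + \<eta>"]) (use \<eta> nonneg bound in auto)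
  have sum: "\<epsilon> + \<epsilon>' < Upsilon G1 d1 G3 d3" using 1 2 \<eta> by linarith
  moreover have "sqrt 2 / 2 \<le> (1::real)" using sqrt2_less_2 by simp
  ultimately have "\<epsilon> + \<epsilon>' \<le> 1" using bound by linarith
  then have "1 / (\<epsilon> + \<epsilon>') + \<epsilon> \<le> 1 / \<epsilon>'" "1 / (\<epsilon> + \<epsilon>') + \<epsilon>' \<le> 1 / \<epsilon>"
    using radius_margin[of \<epsilon> \<epsilon>'] radius_margin[of \<epsilon>' \<epsilon>] 1 2 by (simp_all add: add.commute)
  from UIso_comp[OF assms 1(3) 2(3) _ _ _ this]
  have "Upsilon G1 d1 G3 d3 \<le> \<epsilon> + \<epsilon>'"
    using 1 2 by (auto intro: Upsilon_le)
  with sum show False by simp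
qed

section \<open>Isometric isomorphisms and vanishing of \<open>Upsilon\<close>\<close>

text \<open>
  Writing \<open>h = f (f' h)\<close>, the distance of \<open>f g \<otimes> f g' = f (g \<otimes> g')\<close> to \<open>h\<close> equals that of
  \<open>g \<otimes> g'\<close> to \<open>f' h\<close>; the other defect vanishes by the same computation.
\<close>

lemma isometric_isomorphism_UIso:
  assumes mm: "metric_monoid G1 d1" "metric_monoid G2 d2"
    and f: "f \<in> monoid_isometric_isomorphisms G1 d1 G2 d2" and r: "0 \<le> r"
  defines "f' \<equiv> inv_into (carrier G1) f"
  shows "(restrict f (idball G1 d1 r), restrict f' (idball G2 d2 r)) \<in> UIso 0 G1 d1 G2 d2 r"
proof -
  interpret A: metric_monoid G1 d1 by fact
  interpret B: metric_monoid G2 d2 by fact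
  have hom: "f \<in> hom G1 G2" and bij: "bij_betw f (carrier G1) (carrier G2)"
    and one: "f \<one>\<^bsub>G1\<^esub> = \<one>\<^bsub>G2\<^esub>"
    and iso: "\<And>x y. \<lbrakk>x \<in> carrier G1; y \<in> carrier G1\<rbrakk> \<Longrightarrow> d2 (f x) (f y) = d1 x y"
    using f by (auto simp: monoid_isometric_isomorphisms_def iso_def)
  have ff': "f (f' y) = y" "f' y \<in> carrier G1" if "y \<in> carrier G2" for y
    using bij that unfolding f'_def
    by (auto simp: bij_betw_inv_into_right bij_betw_def inv_into_into)
  have f'f: "f' (f x) = x" "f x \<in> carrier G2" if "x \<in> carrier G1" for x
    using bij that unfolding f'_def by (auto simp: bij_betw_inv_into_left bij_betwE)
  have fmult: "f (x \<otimes>\<^bsub>G1\<^esub> y) = f x \<otimes>\<^bsub>G2\<^esub> f y" if "x \<in> carrier G1" "y \<in> carrier G1" for x y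
    using hom that by (auto simp: hom_def)
  have "d2 (f g \<otimes>\<^bsub>G2\<^esub> f g') h = d1 (g \<otimes>\<^bsub>G1\<^esub> g') (f' h)"
    if "g \<in> carrier G1" "g' \<in> carrier G1" "h \<in> carrier G2" for g g' h
    using that iso[of "g \<otimes>\<^bsub>G1\<^esub> g'" "f' h"] ff' fmult by simp
  moreover have "d1 (f' g \<otimes>\<^bsub>G1\<^esub> f' g') h = d2 (g \<otimes>\<^bsub>G2\<^esub> g') (f h)"
    if "g \<in> carrier G2" "g' \<in> carrier G2" "h \<in> carrier G1" for g g' h
    using that iso[of "f' g \<otimes>\<^bsub>G1\<^esub> f' g'" h] ff' fmult by simp
  ultimately show ?thesis
    using r mm one ff' f'f(2) f'f(1)[of "\<one>\<^bsub>G1\<^esub>"]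
    by (intro UIso_restrictI) (auto simp: defect_le_def A.idball_iff B.idball_iff)
qed

text \<open>
  With \<open>g' = \<one>\<close> the hypothesis reads \<open>d2 (s g) h = d1 g (t h)\<close>. Choosing \<open>h\<close> or \<open>g\<close> so that one
  side vanishes shows that \<open>s\<close> and \<open>t\<close> are mutually inverse; isometry and multiplicativity
  follow by choosing \<open>h\<close> in the range of \<open>s\<close>.
\<close>

lemma zero_defect_isometric_isomorphism:
  assumes "metric_monoid G1 d1" "metric_monoid G2 d2"
    and s: "s \<in> carrier G1 \<rightarrow> carrier G2" "s \<one>\<^bsub>G1\<^esub> = \<one>\<^bsub>G2\<^esub>" and t: "t \<in> carrier G2 \<rightarrow> carrier G1"
    and zero: "defect_le 0 G1 d1 G2 d2 (carrier G1) (carrier G2) s t"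
  shows "s \<in> monoid_isometric_isomorphisms G1 d1 G2 d2"
proof -
  interpret A: metric_monoid G1 d1 by fact
  interpret B: metric_monoid G2 d2 by fact
  have sc: "s g \<in> carrier G2" if "g \<in> carrier G1" for g using s that by auto
  have tc: "t h \<in> carrier G1" if "h \<in> carrier G2" for h using t that by auto
  have dist2: "d2 (s g \<otimes>\<^bsub>G2\<^esub> s g') h = d1 (g \<otimes>\<^bsub>G1\<^esub> g') (t h)"
    if "g \<in> carrier G1" "g' \<in> carrier G1" "h \<in> carrier G2" for g g' h
    using defect_leD[OF zero that] by simp
  have dist: "d2 (s g) h = d1 g (t h)" if "g \<in> carrier G1" "h \<in> carrier G2" for g h
    using dist2[of g "\<one>\<^bsub>G1\<^esub>" h] that s sc by simp
  have ts: "t (s g) = g" if "g \<in> carrier G1" for g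
    using dist[of g "s g"] that sc tc by simp
  have st: "s (t h) = h" if "h \<in> carrier G2" for h
    using dist[of "t h" h] that sc tc by simp
  have "s (g \<otimes>\<^bsub>G1\<^esub> g') = s g \<otimes>\<^bsub>G2\<^esub> s g'" if "g \<in> carrier G1" "g' \<in> carrier G1" for g g'
    using dist2[of g g' "s (g \<otimes>\<^bsub>G1\<^esub> g')"] that ts sc by simp
  moreover have "bij_betw s (carrier G1) (carrier G2)"
    by (rule bij_betw_byWitness[where f' = t]) (use ts st sc tc in auto)
  moreover have "d2 (s x) (s y) = d1 x y" if "x \<in> carrier G1" "y \<in> carrier G1" for x y
    using dist[of x "s y"] ts sc that by simp
  ultimately show ?thesis
    using s sc by (auto simp: monoid_isometric_isomorphisms_def iso_def hom_def)
qed

lemma (in Metric_space) continuous_map_dist: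
  assumes "continuous_map X mtopology f" "continuous_map X mtopology g"
  shows "continuous_map X euclideanreal (\<lambda>x. d (f x) (g x))"
  using continuous_map_mdist[of X Self f g] assms by (simp add: mtopology_of_def)

lemma closedin_Collect_ball:
  assumes "\<And>c. c \<in> C \<Longrightarrow> closedin X {z \<in> topspace X. P c z}"
  shows "closedin X {z \<in> topspace X. \<forall>c\<in>C. P c z}"
proof (cases "C = {}")
  case False
  then have "{z \<in> topspace X. \<forall>c\<in>C. P c z} = (\<Inter>c\<in>C. {z \<in> topspace X. P c z})" by auto
  with False assms show ?thesis by auto
qed simp

text \<open>
  Each inequality in a bound on the defect involves only three values of the maps, so the bound is
  an intersection of conditions closed under pointwise convergence. This is where continuity of the
  multiplication enters.
\<close>

lemma closedin_defect_le:
  assumes "metric_monoid G1 d1" "metric_monoid G2 d2"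
    and s: "\<And>g. g \<in> carrier G1 \<Longrightarrow>
      continuous_map X (Metric_space.mtopology (carrier G2) d2) (\<lambda>z. s z g)"
    and t: "\<And>h. h \<in> carrier G2 \<Longrightarrow>
      continuous_map X (Metric_space.mtopology (carrier G1) d1) (\<lambda>z. t z h)"
    and sub: "A \<subseteq> carrier G1" "B \<subseteq> carrier G2"
  shows "closedin X {z \<in> topspace X. defect_le \<epsilon> G1 d1 G2 d2 A B (s z) (t z)}"
proof -
  interpret A: metric_monoid G1 d1 by fact
  interpret B: metric_monoid G2 d2 by fact
  show ?thesis
    unfolding defect_le_def
  proof (intro closedin_Collect_ball)
    fix g g' h assume *: "g \<in> A" "g' \<in> A" "h \<in> B"
    then have c: "g \<in> carrier G1" "g' \<in> carrier G1" "h \<in> carrier G2" using sub by auto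
    have "continuous_map X B.mtopology ((\<lambda>(x, y). x \<otimes>\<^bsub>G2\<^esub> y) \<circ> (\<lambda>z. (s z g, s z g')))"
      by (rule continuous_map_compose[OF _ B.continuous_mult])
        (use c s in \<open>simp add: continuous_map_paired\<close>)
    then have m: "continuous_map X B.mtopology (\<lambda>z. s z g \<otimes>\<^bsub>G2\<^esub> s z g')"
      by (simp add: o_def)
    have "continuous_map X euclideanreal
        (\<lambda>z. d2 (s z g \<otimes>\<^bsub>G2\<^esub> s z g') h - d1 (g \<otimes>\<^bsub>G1\<^esub> g') (t z h))"
      using c m t by (intro continuous_map_diff A.continuous_map_dist B.continuous_map_dist) auto
    from closedin_continuous_map_preimage[OF this, of "{-\<epsilon>..\<epsilon>}"]
    have "closedin X {z \<in> topspace X.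
        d2 (s z g \<otimes>\<^bsub>G2\<^esub> s z g') h - d1 (g \<otimes>\<^bsub>G1\<^esub> g') (t z h) \<in> {-\<epsilon>..\<epsilon>}}"
      by simp
    moreover have "\<bar>x\<bar> \<le> \<epsilon> \<longleftrightarrow> x \<in> {-\<epsilon>..\<epsilon>}" for x :: real
      by auto
    ultimately
    show "closedin X {z \<in> topspace X.
        \<bar>d2 (s z g \<otimes>\<^bsub>G2\<^esub> s z g') h - d1 (g \<otimes>\<^bsub>G1\<^esub> g') (t z h)\<bar> \<le> \<epsilon>}"
      by simp
  qed
qed


text \<open>
  Members of \<open>UIso\<close> at different scales have different domains. Extending them by the unit puts
  them all into one product of balls whose radii do not depend on the scale.
\<close>

lemma UIso_extend:
  assumes mm: "metric_monoid G1 d1" "metric_monoid G2 d2"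
    and st: "(s, t) \<in> UIso \<epsilon> G1 d1 G2 d2 r" and r: "0 \<le> r" "\<epsilon> \<le> 1"
  defines "s' \<equiv> (\<lambda>g\<in>carrier G1. if g \<in> idball G1 d1 r then s g else \<one>\<^bsub>G2\<^esub>)"
  shows "s' \<in> (\<Pi>\<^sub>E g\<in>carrier G1. idball G2 d2 (d1 \<one>\<^bsub>G1\<^esub> g + 1))"
proof (rule PiE_I)
  interpret A: metric_monoid G1 d1 by fact
  interpret B: metric_monoid G2 d2 by fact
  fix g assume g: "g \<in> carrier G1"
  show "s' g \<in> idball G2 d2 (d1 \<one>\<^bsub>G1\<^esub> g + 1)"
  proof (cases "g \<in> idball G1 d1 r")
    case True
    then show ?thesis
      using UIso_idball_image[OF mm st r(1), of g] g r by (simp add: s'_def)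
  next
    case False
    then show ?thesis using g by (simp add: s'_def B.idball_iff)
  qed
qed (simp add: s'_def)

text \<open>
  The compactness argument. The space \<open>X\<close> of pairs of maps is compact by Tychonoff, and the
  nested closed sets \<open>K n\<close> of approximate isomorphisms have a common point. The condition on the
  unit is carried along in \<open>K n\<close> because \<open>defect_le\<close> alone does not contain it.
\<close>

lemma Upsilon_zero_isometric_isomorphism:
  assumes "proper_metric_monoid G1 d1" "proper_metric_monoid G2 d2"
    and zero: "Upsilon G1 d1 G2 d2 = 0"
  shows "monoid_isometric_isomorphisms G1 d1 G2 d2 \<noteq> {}"
proof -
  interpret A: proper_metric_monoid G1 d1 by fact
  interpret B: proper_metric_monoid G2 d2 by fact
  have mm: "metric_monoid G1 d1" "metric_monoid G2 d2" by unfold_locales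
  define C1 where "C1 g = idball G2 d2 (d1 \<one>\<^bsub>G1\<^esub> g + 1)" for g
  define C2 where "C2 h = idball G1 d1 (d2 \<one>\<^bsub>G2\<^esub> h + 1)" for h
  define T1 where "T1 = product_topology (\<lambda>g. subtopology B.mtopology (C1 g)) (carrier G1)"
  define T2 where "T2 = product_topology (\<lambda>h. subtopology A.mtopology (C2 h)) (carrier G2)"
  define X where "X = prod_topology T1 T2"
  have subC: "C1 g \<subseteq> carrier G2" "C2 h \<subseteq> carrier G1" for g h
    by (auto simp: C1_def C2_def A.idball_iff B.idball_iff)
  have "compact_space T1" "compact_space T2"
    unfolding T1_def T2_def compact_space_product_topology C1_def C2_def idball_def
    by (auto intro!: compact_space_subtopology A.proper B.proper)
  then have compact: "compact_space X"
    by (simp add: X_def compact_space_prod_topology)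
  have top: "topspace X = (\<Pi>\<^sub>E g\<in>carrier G1. C1 g) \<times> (\<Pi>\<^sub>E h\<in>carrier G2. C2 h)"
    using subC by (simp add: X_def T1_def T2_def Int_absorb1)
  have ev1: "continuous_map X B.mtopology (\<lambda>z. fst z g)" if "g \<in> carrier G1" for g
  proof -
    have "continuous_map T1 (subtopology B.mtopology (C1 g)) (\<lambda>f. f g)"
      unfolding T1_def by (rule continuous_map_product_projection[OF that])
    then have "continuous_map T1 B.mtopology (\<lambda>f. f g)"
      by (rule continuous_map_into_fulltopology)
    from continuous_map_compose[OF continuous_map_fst this] show ?thesis
      by (simp add: X_def o_def)
  qed
  have ev2: "continuous_map X A.mtopology (\<lambda>z. snd z h)" if "h \<in> carrier G2" for h
  proof -
    have "continuous_map T2 (subtopology A.mtopology (C2 h)) (\<lambda>f. f h)"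
      unfolding T2_def by (rule continuous_map_product_projection[OF that])
    then have "continuous_map T2 A.mtopology (\<lambda>f. f h)"
      by (rule continuous_map_into_fulltopology)
    from continuous_map_compose[OF continuous_map_snd this] show ?thesis
      by (simp add: X_def o_def)
  qed
  \<comment> \<open>The shift by \<open>2\<close> keeps \<open>\<delta> n\<close> below the cap \<open>sqrt 2 / 2\<close>, where \<open>Upsilon\<close> is a genuine
    infimum, and the radius \<open>n\<close> below \<open>1 / \<delta> n\<close>.\<close>
  define \<delta> where "\<delta> n = 1 / (real n + 2)" for n
  have \<delta>: "0 < \<delta> n" "\<delta> n \<le> sqrt 2 / 2" "\<delta> n \<le> 1" for n
  proof -
    have "(1::real) \<le> sqrt 2" by simp
    moreover have "\<delta> n \<le> 1 / 2" by (simp add: \<delta>_def field_simps)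
    ultimately show "\<delta> n \<le> sqrt 2 / 2" "\<delta> n \<le> 1" by linarith+
  qed (simp add: \<delta>_def)
  define K where "K n = {z \<in> topspace X. d2 (fst z \<one>\<^bsub>G1\<^esub>) \<one>\<^bsub>G2\<^esub> \<in> {0} \<and>
    defect_le (\<delta> n) G1 d1 G2 d2 (idball G1 d1 n) (idball G2 d2 n) (fst z) (snd z)}" for n :: nat
  have "closedin X (K n)" for n
  proof -
    let ?D = "{z \<in> topspace X.
        defect_le (\<delta> n) G1 d1 G2 d2 (idball G1 d1 n) (idball G2 d2 n) (fst z) (snd z)}"
    let ?E = "{z \<in> topspace X. d2 (fst z \<one>\<^bsub>G1\<^esub>) \<one>\<^bsub>G2\<^esub> \<in> {0}}"
    have "closedin X ?D"
      by (rule closedin_defect_le[OF mm ev1 ev2]) (simp_all add: A.idball_iff B.idball_iff subset_iff)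
    moreover have "closedin X ?E"
      by (rule closedin_continuous_map_preimage[OF B.continuous_map_dist]) (simp_all add: ev1)
    moreover have "K n = ?D \<inter> ?E"
      unfolding K_def by blast
    ultimately show ?thesis
      by (simp only: closedin_Int)
  qed
  moreover have "K n \<noteq> {}" for n
  proof -
    obtain \<epsilon> s t where \<epsilon>: "0 < \<epsilon>" "\<epsilon> < \<delta> n" and st: "(s, t) \<in> UIso \<epsilon> G1 d1 G2 d2 (1 / \<epsilon>)"
      by (rule Upsilon_lessE[OF mm, of "\<delta> n"]) (use zero \<delta> in auto)
    have r: "0 \<le> 1 / \<epsilon>" "\<epsilon> \<le> 1" using \<epsilon> \<delta>(3)[of n] by auto
    have "real n \<le> 1 / \<delta> n" by (simp add: \<delta>_def)
    also have "\<dots> \<le> 1 / \<epsilon>" using \<epsilon> by (simp add: frac_le)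
    finally have sub: "idball G1 d1 n \<subseteq> idball G1 d1 (1 / \<epsilon>)" "idball G2 d2 n \<subseteq> idball G2 d2 (1 / \<epsilon>)"
      by (simp_all add: A.idball_mono B.idball_mono)
    define s' where "s' = (\<lambda>g\<in>carrier G1. if g \<in> idball G1 d1 (1 / \<epsilon>) then s g else \<one>\<^bsub>G2\<^esub>)"
    define t' where "t' = (\<lambda>h\<in>carrier G2. if h \<in> idball G2 d2 (1 / \<epsilon>) then t h else \<one>\<^bsub>G1\<^esub>)"
    have "(s', t') \<in> topspace X"
      using UIso_extend[OF mm st r] UIso_extend[OF mm(2,1) UIso_swap[THEN iffD1, OF st] r]
      by (simp add: top C1_def C2_def s'_def t'_def)
    moreover have "s' \<one>\<^bsub>G1\<^esub> = \<one>\<^bsub>G2\<^esub>"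
      using st by (simp add: s'_def UIso_iff)
    moreover have "defect_le (\<delta> n) G1 d1 G2 d2 (idball G1 d1 n) (idball G2 d2 n) s' t'"
    proof -
      have "defect_le (\<delta> n) G1 d1 G2 d2 (idball G1 d1 n) (idball G2 d2 n) s t"
        using st sub \<epsilon> by (auto simp: UIso_iff intro: defect_le_mono)
      moreover have "s' g = s g" if "g \<in> idball G1 d1 n" for g
        using that sub by (auto simp: s'_def A.idball_iff)
      moreover have "t' h = t h" if "h \<in> idball G2 d2 n" for h
        using that sub by (auto simp: t'_def B.idball_iff)
      ultimately show ?thesis by (simp cong: defect_le_cong)
    qed
    ultimately have "(s', t') \<in> K n" by (simp add: K_def)
    then show ?thesis by blast
  qed
  moreover have "decseq K"
  proof (rule decseq_SucI)
    fix n
    have "\<delta> (Suc n) \<le> \<delta> n" by (simp add: \<delta>_def frac_le)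
    then show "K (Suc n) \<subseteq> K n"
      using A.idball_mono[of "real n" "real (Suc n)"] B.idball_mono[of "real n" "real (Suc n)"]
      by (auto simp: K_def elim: defect_le_mono)
  qed
  ultimately have "(\<Inter>n. K n) \<noteq> {}"
    by (rule compact_space_imp_nest[OF compact])
  then obtain s t where st: "(s, t) \<in> K n" for n by fast
  have maps: "s \<in> carrier G1 \<rightarrow> carrier G2" "t \<in> carrier G2 \<rightarrow> carrier G1"
    using st[of 0] by (auto simp: K_def top PiE_iff intro: subC[THEN subsetD])
  then have one: "s \<one>\<^bsub>G1\<^esub> = \<one>\<^bsub>G2\<^esub>"
    using st[of 0] by (auto simp: K_def Pi_iff)
  have "defect_le 0 G1 d1 G2 d2 (carrier G1) (carrier G2) s t"
    unfolding defect_le_def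
  proof (intro ballI)
    fix g g' h assume c: "g \<in> carrier G1" "g' \<in> carrier G1" "h \<in> carrier G2"
    \<comment> \<open>From \<open>N\<close> on, the three points lie in the balls on which \<open>K n\<close> controls the defect.\<close>
    obtain N :: nat where N: "max (max (d1 \<one>\<^bsub>G1\<^esub> g) (d1 \<one>\<^bsub>G1\<^esub> g')) (d2 \<one>\<^bsub>G2\<^esub> h) \<le> N"
      using real_arch_simple by blast
    have "\<bar>d2 (s g \<otimes>\<^bsub>G2\<^esub> s g') h - d1 (g \<otimes>\<^bsub>G1\<^esub> g') (t h)\<bar> \<le> \<delta> n" if "n \<ge> N" for n
    proof -
      have "defect_le (\<delta> n) G1 d1 G2 d2 (idball G1 d1 n) (idball G2 d2 n) s t"
        using st[of n] by (simp add: K_def)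
      then show ?thesis
        by (rule defect_leD) (use c N that in \<open>auto simp: A.idball_iff B.idball_iff\<close>)
    qed
    moreover have "\<delta> \<longlonglongrightarrow> 0"
      unfolding \<delta>_def by real_asymp
    ultimately show "\<bar>d2 (s g \<otimes>\<^bsub>G2\<^esub> s g') h - d1 (g \<otimes>\<^bsub>G1\<^esub> g') (t h)\<bar> \<le> 0"
      by (meson Lim_bounded2)
  qed
  from zero_defect_isometric_isomorphism[OF mm maps(1) one maps(2) this]
  show ?thesis by blast
qed

lemma isometric_isomorphism_Upsilon_zero:
  assumes "metric_monoid G1 d1" "metric_monoid G2 d2"
    and "f \<in> monoid_isometric_isomorphisms G1 d1 G2 d2"
  shows "Upsilon G1 d1 G2 d2 = 0"
proof (rule antisym)
  show "Upsilon G1 d1 G2 d2 \<le> 0"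
  proof (rule field_le_epsilon)
    fix \<epsilon> :: real assume \<epsilon>: "0 < \<epsilon>"
    define f' where "f' = inv_into (carrier G1) f"
    have "(restrict f (idball G1 d1 (1 / \<epsilon>)), restrict f' (idball G2 d2 (1 / \<epsilon>)))
        \<in> UIso 0 G1 d1 G2 d2 (1 / \<epsilon>)"
      unfolding f'_def by (rule isometric_isomorphism_UIso[OF assms]) (use \<epsilon> in simp)
    then have "(restrict f (idball G1 d1 (1 / \<epsilon>)), restrict f' (idball G2 d2 (1 / \<epsilon>)))
        \<in> UIso \<epsilon> G1 d1 G2 d2 (1 / \<epsilon>)"
      using \<epsilon> unfolding UIso_iff by (auto intro: defect_le_mono)
    from Upsilon_le[OF this \<epsilon>] show "Upsilon G1 d1 G2 d2 \<le> 0 + \<epsilon>" by simp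
  qed
qed (rule Upsilon_nonneg[OF assms(1,2)])

text \<open>A group homomorphism preserves the unit automatically.\<close>

lemma group_isometric_isomorphisms_eq:
  assumes "group G1" "group G2"
  shows "group_isometric_isomorphisms G1 d1 G2 d2 = monoid_isometric_isomorphisms G1 d1 G2 d2"
  using hom_one[OF _ assms]
  by (auto simp: group_isometric_isomorphisms_def monoid_isometric_isomorphisms_def iso_def)

section \<open>The metric properties of \<open>Upsilon\<close>\<close>

theorem theorem2p12:
  fixes G1 :: "('a, 'm) monoid_scheme" and d1 :: "'a \<Rightarrow> 'a \<Rightarrow> real"
    and G2 :: "('b, 'n) monoid_scheme" and d2 :: "'b \<Rightarrow> 'b \<Rightarrow> real"
    and G3 :: "('c, 'p) monoid_scheme" and d3 :: "'c \<Rightarrow> 'c \<Rightarrow> real"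
  assumes "proper_metric_monoid G1 d1"
    and "proper_metric_monoid G2 d2"
    and "proper_metric_monoid G3 d3"
  shows "Upsilon G1 d1 G2 d2 \<le> sqrt 2 / 2 \<and>
    Upsilon G1 d1 G2 d2 = Upsilon G2 d2 G1 d1 \<and>
    Upsilon G1 d1 G3 d3 \<le> Upsilon G1 d1 G2 d2 + Upsilon G2 d2 G3 d3 \<and>
    (Upsilon G1 d1 G2 d2 = 0 \<longleftrightarrow> monoid_isometric_isomorphisms G1 d1 G2 d2 \<noteq> {}) \<and>
    (proper_metric_group G1 d1 \<and> proper_metric_group G2 d2 \<and> proper_metric_group G3 d3 \<longrightarrow>
      0 \<le> Upsilon G1 d1 G2 d2 \<and>
      Upsilon G1 d1 G2 d2 = Upsilon G2 d2 G1 d1 \<and>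
      Upsilon G1 d1 G3 d3 \<le> Upsilon G1 d1 G2 d2 + Upsilon G2 d2 G3 d3 \<and>
      (Upsilon G1 d1 G2 d2 = 0 \<longleftrightarrow> group_isometric_isomorphisms G1 d1 G2 d2 \<noteq> {}))"
proof -
  interpret A: proper_metric_monoid G1 d1 by fact
  interpret B: proper_metric_monoid G2 d2 by fact
  interpret C: proper_metric_monoid G3 d3 by fact
  have mm: "metric_monoid G1 d1" "metric_monoid G2 d2" "metric_monoid G3 d3"
    by unfold_locales
  have zero_iff: "Upsilon G1 d1 G2 d2 = 0 \<longleftrightarrow> monoid_isometric_isomorphisms G1 d1 G2 d2 \<noteq> {}"
    using Upsilon_zero_isometric_isomorphism[OF assms(1,2)]
      isometric_isomorphism_Upsilon_zero[OF mm(1,2)] by blast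
  have "group_isometric_isomorphisms G1 d1 G2 d2 = monoid_isometric_isomorphisms G1 d1 G2 d2"
    if "proper_metric_group G1 d1" "proper_metric_group G2 d2"
    by (rule group_isometric_isomorphisms_eq)
      (use that in \<open>simp_all add: proper_metric_group_def metric_group_def\<close>)
  then show ?thesis
    using zero_iff Upsilon_le_sqrt2 Upsilon_commute Upsilon_triangle[OF mm] Upsilon_nonneg[OF mm(1,2)]
    by metis
qed

end
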